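(* Fix $b>0$. Suppose $d_1,\dots,d_n$ are i.i.d. from an arbitrary distribution $X$ on $\mathbb{R}$ with probability density function $f_X$ and cumulative distribution function $F_X$. Let $\tau=\tau_n$ be the pivot of $d=(d_1,\dots,d_n)$ for the simplex $\Delta_b\subset\mathbb{R}^n$ and $\mathcal{I}_\tau:=\{i\in\{1,\dots,n\}: d_i>\tau\}$. Then, for any $\epsilon>0$, $$\lim_{n\to\infty}P\left(\frac{|\mathcal{I}_\tau|}{n}\le\epsilon\right)=1 .$$
   Context: $\Delta_b:=\{v\in\mathbb{R}^n:\sum_{i=1}^n v_i=b,\ v\ge0\}$ and $\mathrm{proj}_{\Delta_b}(d):=\mathrm{argmin}_{v\in\Delta_b}\|v-d\|_2$. The pivot $\tau$ is the unique real number with $\mathrm{proj}_{\Delta_b}(d)_i=\max\{d_i-\tau,0\}$ for all $i$; thus $\mathcal{I}_\tau$ is the set of indices of the nonzero entries of the projection. *)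

theory Defs
  imports "HOL-Probability.Probability"
begin

text \<open>
  As \<open>n\<close> varies in the limit, a vector in \<open>\<real>\<^sup>n\<close> is a function on the index set \<open>{1..n}\<close>.
  Elements of the simplex are extensional, so that a point is determined by its \<open>n\<close> coordinates
  and the minimizer of the distance is unique; for the projected point \<open>d\<close> only the values on
  \<open>{1..n}\<close> matter.
\<close>

definition scaled_simplex :: "nat \<Rightarrow> real \<Rightarrow> (nat \<Rightarrow> real) set" where
  "scaled_simplex n b = {v \<in> extensional {1..n}. (\<Sum>i = 1..n. v i) = b \<and> (\<forall>i\<in>{1..n}. 0 \<le> v i)}"

definition simplex_proj :: "nat \<Rightarrow> real \<Rightarrow> (nat \<Rightarrow> real) \<Rightarrow> (nat \<Rightarrow> real)" where
  "simplex_proj n b d = arg_min_on (\<lambda>v. L2_set (\<lambda>i. v i - d i) {1..n}) (scaled_simplex n b)"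

text \<open>The pivot is well defined for \<open>b > 0\<close> and \<open>n \<ge> 1\<close>.\<close>

definition pivot :: "nat \<Rightarrow> real \<Rightarrow> (nat \<Rightarrow> real) \<Rightarrow> real" where
  "pivot n b d = (THE \<tau>. \<forall>i\<in>{1..n}. simplex_proj n b d i = max (d i - \<tau>) 0)"

definition active_set :: "nat \<Rightarrow> real \<Rightarrow> (nat \<Rightarrow> real) \<Rightarrow> nat set" where
  "active_set n b d = {i \<in> {1..n}. d i > pivot n b d}"

end

theory Submission
  imports Defs
begin

text \<open>
  An index \<open>i\<close> is active iff \<open>\<Sum>j. max (d j - d i) 0 < b\<close>. Hence, for \<open>\<delta> > 0\<close>, at most \<open>2 n b / \<delta>\<close>
  ordered pairs of active indices have values more than \<open>\<delta>\<close> apart, and the squared number of active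
  indices exceeds the number of pairs with \<open>\<bar>d i - d j\<bar> \<le> \<delta>\<close> by at most \<open>2 n b / \<delta>\<close>. The expected number
  of such pairs is at most \<open>n + n\<^sup>2 q\<close> with \<open>q = P(\<bar>d 1 - d 2\<bar> \<le> \<delta>)\<close>, so Markov's inequality bounds the
  probability of more than \<open>\<epsilon> n\<close> active indices by \<open>(q + O(1/n)) / \<epsilon>\<^sup>2\<close>. As the law of \<open>d i\<close> has no atoms,
  \<open>q\<close> vanishes as \<open>\<delta>\<close> tends to \<open>0\<close>.
\<close>

section \<open>The pivot of a fixed vector\<close>

text \<open>Intermediate value theorem: the excess is continuous in the threshold, vanishes at the
  largest coordinate, and is at least \<open>b\<close> at \<open>d 1 - b\<close>, where coordinate 1
  alone contributes \<open>b\<close>.\<close>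

lemma sum_excess_pivot_exists:
  fixes d :: "nat \<Rightarrow> real"
  assumes "b > 0" "n \<ge> 1"
  obtains \<tau> where "(\<Sum>i = 1..n. max (d i - \<tau>) 0) = b"
proof -
  define g where "g t = (\<Sum>i = 1..n. max (d i - t) 0)" for t
  define u where "u = Max (d ` {1..n})"
  have le_u: "d i \<le> u" if "i \<in> {1..n}" for i
    using that by (simp add: u_def)
  then have "g u = 0"
    unfolding g_def by (intro sum.neutral) auto
  moreover have "b \<le> g (d 1 - b)"
    using member_le_sum[of 1 "{1..n}" "\<lambda>i. max (d i - (d 1 - b)) 0"] assms
    by (auto simp: g_def)
  moreover have "d 1 - b \<le> u"
    using le_u[of 1] assms by auto
  moreover have "continuous_on {d 1 - b..u} g"
    unfolding g_def by (intro continuous_intros)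
  ultimately obtain \<tau> where "g \<tau> = b"
    using IVT2'[of g u b "d 1 - b"] assms by auto
  then show ?thesis
    using that by (simp add: g_def)
qed

text \<open>The truncation \<open>v\<close> satisfies \<open>v - d \<ge> -\<tau>\<close>, with equality where \<open>v > 0\<close>;
  hence \<open>\<langle>v - d, w - v\<rangle> \<ge> 0\<close> for every \<open>w\<close> in the simplex.\<close>

lemma simplex_proj_eq:
  fixes d :: "nat \<Rightarrow> real"
  assumes \<tau>: "(\<Sum>i = 1..n. max (d i - \<tau>) 0) = b"
  shows "simplex_proj n b d = (\<lambda>i\<in>{1..n}. max (d i - \<tau>) 0)"
proof -
  define v where "v = (\<lambda>i\<in>{1..n}. max (d i - \<tau>) 0)"
  define D where "D w = L2_set (\<lambda>i. w i - d i) {1..n}" for w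
  define S where "S = scaled_simplex n b"
  have v: "v \<in> S"
    using \<tau> by (auto simp: S_def v_def scaled_simplex_def)
  \<comment> \<open>Expanding the square around \<open>v\<close> leaves a nonnegative cross term.
    Keeping the squared distance from \<open>w\<close> to \<open>v\<close> in the bound makes it
    yield minimality and uniqueness at once.\<close>
  have dist: "(\<Sum>i = 1..n. (w i - v i)\<^sup>2) + (D v)\<^sup>2 \<le> (D w)\<^sup>2" if w: "w \<in> S" for w
  proof -
    have "(\<Sum>i = 1..n. - \<tau> * (w i - v i)) \<le> (\<Sum>i = 1..n. (v i - d i) * (w i - v i))"
    proof (rule sum_mono)
      fix i assume i: "i \<in> {1..n}"
      show "- \<tau> * (w i - v i) \<le> (v i - d i) * (w i - v i)"
      proof (cases "d i > \<tau>")
        case False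
        moreover from i have "w i \<ge> 0"
          using w by (auto simp: S_def scaled_simplex_def)
        ultimately show ?thesis
          using i by (auto simp: v_def max_def mult_right_mono)
      qed (use i in \<open>simp add: v_def\<close>)
    qed
    \<comment> \<open>The coordinates of \<open>v\<close> and \<open>w\<close> have the same sum
      \<open>b\<close>, so the constant factor meets a zero total.\<close>
    moreover have "(\<Sum>i = 1..n. - \<tau> * (w i - v i)) = 0"
      unfolding sum_distrib_left[symmetric] using v w
      by (simp add: S_def scaled_simplex_def sum_subtractf)
    ultimately have "0 \<le> (\<Sum>i = 1..n. (v i - d i) * (w i - v i))"
      by simp
    moreover have "(\<Sum>i = 1..n. (w i - d i)\<^sup>2) = (\<Sum>i = 1..n. (w i - v i)\<^sup>2)
        + (\<Sum>i = 1..n. (v i - d i)\<^sup>2) + 2 * (\<Sum>i = 1..n. (v i - d i) * (w i - v i))"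
      unfolding sum_distrib_left sum.distrib[symmetric]
      by (intro sum.cong) (auto simp: power2_eq_square algebra_simps)
    ultimately show ?thesis
      by (simp add: D_def L2_set_def sum_nonneg)
  qed
  have D_nonneg: "0 \<le> D w" for w
    by (simp add: D_def)
  have min: "is_arg_min D (\<lambda>w. w \<in> S) v"
    unfolding is_arg_min_linorder
  proof (intro conjI ballI allI impI v)
    fix w assume "w \<in> S"
    with dist[of w] sum_nonneg[of "{1..n}" "\<lambda>i. (w i - v i)\<^sup>2"] have "(D v)\<^sup>2 \<le> (D w)\<^sup>2"
      by simp
    then show "D v \<le> D w"
      by (rule power2_le_imp_le) (rule D_nonneg)
  qed
  \<comment> \<open>\<open>arg_min_on\<close> is a Hilbert choice among minimizers, so its value is
    known only once the minimizer is unique; extensionality reduces this to the \<open>n\<close>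
    coordinates.\<close>
  have "w = v" if "is_arg_min D (\<lambda>w. w \<in> S) w" for w
  proof (rule extensionalityI[of _ "{1..n}"])
    have w: "w \<in> S" "D w \<le> D v"
      using that v by (auto simp: is_arg_min_linorder)
    then show "w \<in> extensional {1..n}"
      by (simp add: S_def scaled_simplex_def)
    from w have "(D w)\<^sup>2 \<le> (D v)\<^sup>2"
      by (intro power_mono D_nonneg)
    with dist[OF w(1)] have "(\<Sum>i = 1..n. (w i - v i)\<^sup>2) \<le> 0"
      by simp
    then have "(\<Sum>i = 1..n. (w i - v i)\<^sup>2) = 0"
      by (intro antisym sum_nonneg) auto
    then show "w i = v i" if "i \<in> {1..n}" for i
      using that by (simp add: sum_nonneg_eq_0_iff)
  qed (simp add: v_def)
  with min have "arg_min_on D S = v"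
    unfolding arg_min_on_def arg_min_def by blast
  then show ?thesis
    by (simp add: simplex_proj_def D_def[abs_def] S_def v_def)
qed

text \<open>A threshold with excess \<open>b\<close> satisfies the description of the pivot by the
  projection formula. It is the only one: since \<open>b > 0\<close>, some coordinate of the
  projection is positive, and a positive coordinate determines the threshold.\<close>

lemma sum_excess_pivot:
  fixes d :: "nat \<Rightarrow> real"
  assumes "b > 0" "n \<ge> 1"
  shows "(\<Sum>i = 1..n. max (d i - pivot n b d) 0) = b"
proof -
  obtain \<tau> where \<tau>: "(\<Sum>i = 1..n. max (d i - \<tau>) 0) = b"
    using sum_excess_pivot_exists assms by blast
  have "\<exists>i\<in>{1..n}. max (d i - \<tau>) 0 \<noteq> 0"
    using \<tau> \<open>b > 0\<close> by (metis (no_types, lifting) less_irrefl sum.neutral)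
  then obtain k where k: "k \<in> {1..n}" "\<tau> < d k"
    by (auto simp: max_def split: if_splits)
  have "pivot n b d = \<tau>"
    unfolding pivot_def simplex_proj_eq[OF \<tau>]
  proof (rule the_equality)
    fix \<sigma> assume "\<forall>i\<in>{1..n}. (\<lambda>i\<in>{1..n}. max (d i - \<tau>) 0) i = max (d i - \<sigma>) 0"
    then have "(\<lambda>i\<in>{1..n}. max (d i - \<tau>) 0) k = max (d k - \<sigma>) 0"
      using k by blast
    with k have "max (d k - \<tau>) 0 = max (d k - \<sigma>) 0"
      by simp
    with k show "\<sigma> = \<tau>"
      by (auto simp: max_def split: if_splits)
  qed simp
  with \<tau> show ?thesis
    by simp
qed

section \<open>Counting active indices\<close>

text \<open>The excess decreases in the threshold and equals \<open>b\<close> at the pivot. Testing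
  it at \<open>d i\<close> itself replaces the implicitly defined pivot by an explicit finite
  sum.\<close>

lemma active_set_eq:
  fixes d :: "nat \<Rightarrow> real"
  assumes "b > 0" "n \<ge> 1"
  shows "active_set n b d = {i \<in> {1..n}. (\<Sum>j = 1..n. max (d j - d i) 0) < b}"
proof -
  let ?\<tau> = "pivot n b d"
  have "?\<tau> < d i \<longleftrightarrow> (\<Sum>j = 1..n. max (d j - d i) 0) < b" if i: "i \<in> {1..n}" for i
  proof
    assume "?\<tau> < d i"
    \<comment> \<open>Strictness comes from \<open>j = i\<close>, which contributes 0 on the left
      and a positive amount on the right.\<close>
    then have "(\<Sum>j = 1..n. max (d j - d i) 0) < (\<Sum>j = 1..n. max (d j - ?\<tau>) 0)"
      using i by (intro sum_strict_mono_ex1 bexI[of _ i]) auto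
    then show "(\<Sum>j = 1..n. max (d j - d i) 0) < b"
      by (simp only: sum_excess_pivot[OF assms])
  next
    assume less: "(\<Sum>j = 1..n. max (d j - d i) 0) < b"
    show "?\<tau> < d i"
    proof (rule ccontr)
      assume "\<not> ?\<tau> < d i"
      then have "(\<Sum>j = 1..n. max (d j - ?\<tau>) 0) \<le> (\<Sum>j = 1..n. max (d j - d i) 0)"
        by (intro sum_mono) auto
      with less show False
        by (simp only: sum_excess_pivot[OF assms])
    qed
  qed
  then show ?thesis
    by (auto simp: active_set_def)
qed

lemma card_active_set_square_le:
  fixes d :: "nat \<Rightarrow> real"
  assumes "b > 0" "n \<ge> 1" "\<delta> > 0"
  shows "(real (card (active_set n b d)))\<^sup>2
    \<le> (\<Sum>i = 1..n. \<Sum>j = 1..n. of_bool (\<bar>d i - d j\<bar> \<le> \<delta>)) + 2 * real n * b / \<delta>"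
proof -
  define A where "A = active_set n b d"
  have A: "A \<subseteq> {1..n}"
    by (auto simp: A_def active_set_def)
  then have "finite A" and cardA: "card A \<le> n"
    using finite_subset card_mono[OF _ A] by auto
  have excess: "(\<Sum>i\<in>A. \<Sum>j\<in>A. max (d j - d i) 0) \<le> real n * b"
  proof -
    have "(\<Sum>j\<in>A. max (d j - d i) 0) \<le> b" if "i \<in> A" for i
    proof -
      have "(\<Sum>j\<in>A. max (d j - d i) 0) \<le> (\<Sum>j = 1..n. max (d j - d i) 0)"
        by (rule sum_mono2) (use A in auto)
      also have "\<dots> \<le> b"
        using that by (simp add: A_def active_set_eq[OF assms(1,2)])
      finally show ?thesis .
    qed
    then have "(\<Sum>i\<in>A. \<Sum>j\<in>A. max (d j - d i) 0) \<le> (\<Sum>i\<in>A. b)"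
      by (rule sum_mono)
    also have "\<dots> \<le> real n * b"
      using cardA assms(1) by simp
    finally show ?thesis .
  qed
  have "(real (card A))\<^sup>2 = (\<Sum>i\<in>A. \<Sum>j\<in>A. 1)"
    by (simp add: power2_eq_square)
  \<comment> \<open>A pair that is not close has distance above \<delta>; the two \<open>max\<close>
    terms add up to its distance divided by \<delta>, hence exceed 1.\<close>
  also have "\<dots> \<le> (\<Sum>i\<in>A. \<Sum>j\<in>A. of_bool (\<bar>d i - d j\<bar> \<le> \<delta>)
      + (max (d j - d i) 0 / \<delta> + max (d i - d j) 0 / \<delta>))"
    using assms(3) by (intro sum_mono) (auto simp: max_def field_simps)
  also have "\<dots> = (\<Sum>i\<in>A. \<Sum>j\<in>A. of_bool (\<bar>d i - d j\<bar> \<le> \<delta>))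
      + ((\<Sum>i\<in>A. \<Sum>j\<in>A. max (d j - d i) 0) / \<delta> + (\<Sum>i\<in>A. \<Sum>j\<in>A. max (d i - d j) 0) / \<delta>)"
    by (simp add: sum.distrib sum_divide_distrib)
  also have "(\<Sum>i\<in>A. \<Sum>j\<in>A. max (d i - d j) 0) = (\<Sum>i\<in>A. \<Sum>j\<in>A. max (d j - d i) 0)"
    by (rule sum.swap)
  also have "(\<Sum>i\<in>A. \<Sum>j\<in>A. of_bool (\<bar>d i - d j\<bar> \<le> \<delta>))
      \<le> (\<Sum>i = 1..n. \<Sum>j = 1..n. of_bool (\<bar>d i - d j\<bar> \<le> \<delta>) :: real)"
    by (rule order_trans[OF sum_mono[OF sum_mono2] sum_mono2]) (use A in \<open>auto intro!: sum_nonneg\<close>)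
  also have "(\<Sum>i\<in>A. \<Sum>j\<in>A. max (d j - d i) 0) / \<delta> + (\<Sum>i\<in>A. \<Sum>j\<in>A. max (d j - d i) 0) / \<delta>
      \<le> 2 * real n * b / \<delta>"
    using divide_right_mono[OF excess, of \<delta>] assms(3) by simp
  finally show ?thesis
    by (simp add: A_def)
qed

section \<open>Mass near the diagonal for an atomless law\<close>

text \<open>The strips decrease to the diagonal, so continuity from above applies. By Fubini the
  diagonal is null, as its sections are singletons.\<close>

lemma near_diagonal_tendsto_0:
  fixes \<mu> :: "real measure"
  assumes "finite_measure \<mu>" and [measurable_cong]: "sets \<mu> = sets borel"
    and null: "\<And>x. emeasure \<mu> {x} = 0"
  shows "(\<lambda>m. measure (\<mu> \<Otimes>\<^sub>M \<mu>) {(x, y). \<bar>x - y\<bar> \<le> inverse (real (Suc m))}) \<longlonglongrightarrow> 0"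
proof -
  interpret finite_measure \<mu> by fact
  interpret P: pair_sigma_finite \<mu> \<mu> ..
  interpret PF: finite_measure "\<mu> \<Otimes>\<^sub>M \<mu>"
    by (rule finite_measure_pair_measure) fact+
  define A where "A m = {(x, y). \<bar>x - y\<bar> \<le> inverse (real (Suc m))}" for m
  have space: "space \<mu> = UNIV"
    using sets_eq_imp_space_eq[OF assms(2)] by simp
  have A_sets [measurable]: "A m \<in> sets (\<mu> \<Otimes>\<^sub>M \<mu>)" for m
  proof -
    have "{p \<in> space (\<mu> \<Otimes>\<^sub>M \<mu>). \<bar>fst p - snd p\<bar> \<le> inverse (real (Suc m))} \<in> sets (\<mu> \<Otimes>\<^sub>M \<mu>)"
      by measurable
    also have "{p \<in> space (\<mu> \<Otimes>\<^sub>M \<mu>). \<bar>fst p - snd p\<bar> \<le> inverse (real (Suc m))} = A m"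
      by (auto simp: A_def space_pair_measure space)
    finally show ?thesis .
  qed
  have "decseq A"
    unfolding A_def decseq_def
    by (auto simp: intro: order_trans le_imp_inverse_le)
  then have "(\<lambda>m. measure (\<mu> \<Otimes>\<^sub>M \<mu>) (A m)) \<longlonglongrightarrow> measure (\<mu> \<Otimes>\<^sub>M \<mu>) (\<Inter>m. A m)"
    by (intro PF.finite_Lim_measure_decseq) auto
  moreover have "emeasure (\<mu> \<Otimes>\<^sub>M \<mu>) (\<Inter>m. A m) = 0"
  proof -
    have "Pair x -` (\<Inter>m. A m) = {x}" for x
    proof -
      have "y = x" if "\<And>m. \<bar>x - y\<bar> \<le> inverse (real (Suc m))" for y
      proof (rule ccontr)
        assume "y \<noteq> x"
        then obtain m where "inverse (real (Suc m)) < \<bar>x - y\<bar>"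
          using reals_Archimedean[of "\<bar>x - y\<bar>"] by auto
        with that[of m] show False
          by simp
      qed
      then show ?thesis
        by (auto simp: A_def)
    qed
    moreover have "(\<Inter>m. A m) \<in> sets (\<mu> \<Otimes>\<^sub>M \<mu>)"
      by measurable
    ultimately show ?thesis
      by (simp add: emeasure_pair_measure_alt null)
  qed
  ultimately show ?thesis
    by (simp add: A_def measure_def)
qed

section \<open>Probability of many active indices\<close>

text \<open>The explicit criterion turns the cardinality into a finite sum of measurable indicators,
  bypassing measurability of the projection and the pivot.\<close>

lemma (in prob_space) measurable_card_active_set:
  fixes d :: "nat \<Rightarrow> 'a \<Rightarrow> real"
  assumes rv: "\<And>i. i \<ge> 1 \<Longrightarrow> random_variable borel (d i)" and "b > 0" "n \<ge> 1"
  shows "(\<lambda>\<omega>. real (card (active_set n b (\<lambda>i. d i \<omega>)))) \<in> borel_measurable M"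
proof -
  have [measurable]: "random_variable borel (d i)" if "i \<in> {1..n}" for i
    using that rv by simp
  have "(\<lambda>\<omega>. \<Sum>i = 1..n. of_bool ((\<Sum>j = 1..n. max (d j \<omega> - d i \<omega>) 0) < b) :: real)
      \<in> borel_measurable M"
    by measurable
  moreover have "real (card (active_set n b (\<lambda>i. d i \<omega>)))
      = (\<Sum>i = 1..n. of_bool ((\<Sum>j = 1..n. max (d j \<omega> - d i \<omega>) 0) < b))" for \<omega>
    by (simp add: active_set_eq[OF assms(2,3)] Int_def)
  ultimately show ?thesis
    by simp
qed

text \<open>Markov's inequality for the bound on the squared count. Independence enters only through
  \<open>close\<close>, and for fixed \<delta> the bound separates a term free of \<open>n\<close>
  from one of order \<open>1 / n\<close>.\<close>

lemma (in prob_space) prob_card_active_set_gt_le: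
  fixes d :: "nat \<Rightarrow> 'a \<Rightarrow> real"
  assumes rv: "\<And>i. i \<ge> 1 \<Longrightarrow> random_variable borel (d i)"
    and "b > 0" "n \<ge> 1" "\<delta> > 0" "\<epsilon> > 0" "q \<ge> 0"
    and close: "\<And>i j. i \<ge> 1 \<Longrightarrow> j \<ge> 1 \<Longrightarrow> i \<noteq> j \<Longrightarrow>
      prob {\<omega> \<in> space M. \<bar>d i \<omega> - d j \<omega>\<bar> \<le> \<delta>} \<le> q"
  shows "prob {\<omega> \<in> space M. \<epsilon> < real (card (active_set n b (\<lambda>i. d i \<omega>))) / real n}
    \<le> (q + (1 + 2 * b / \<delta>) / real n) / \<epsilon>\<^sup>2"
proof -
  have [measurable]: "random_variable borel (d i)" if "i \<in> {1..n}" for i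
    using that rv by simp
  define C where "C i j = {\<omega> \<in> space M. \<bar>d i \<omega> - d j \<omega>\<bar> \<le> \<delta>}" for i j
  have C [measurable]: "C i j \<in> events" if "i \<in> {1..n}" "j \<in> {1..n}" for i j
    using that unfolding C_def by measurable
  \<comment> \<open>\<open>W\<close> is the right-hand side of
    \<open>card_active_set_square_le\<close> as a random variable.\<close>
  define W where "W \<omega> = (\<Sum>i = 1..n. \<Sum>j = 1..n. indicat_real (C i j) \<omega>) + 2 * real n * b / \<delta>" for \<omega>
  have int: "integrable M (indicat_real (C i j))" if "i \<in> {1..n}" "j \<in> {1..n}" for i j
    using C[OF that] by (simp add: emeasure_eq_measure)
  have W: "integrable M W"
    unfolding W_def using int by (intro Bochner_Integration.integrable_add Bochner_Integration.integrable_sum) auto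
  have W_nonneg: "0 \<le> W \<omega>" for \<omega>
    unfolding W_def using assms by (intro add_nonneg_nonneg sum_nonneg) auto
  have "expectation W = (\<Sum>i = 1..n. \<Sum>j = 1..n. prob (C i j)) + 2 * real n * b / \<delta>"
  proof -
    have "expectation (indicat_real (C i j)) = prob (C i j)" for i j
      by (simp add: C_def Int_def conj_commute)
    then have "expectation (\<lambda>\<omega>. \<Sum>i = 1..n. \<Sum>j = 1..n. indicat_real (C i j) \<omega>)
        = (\<Sum>i = 1..n. \<Sum>j = 1..n. prob (C i j))"
      using int by (simp only: Bochner_Integration.integral_sum Bochner_Integration.integrable_sum
        cong: sum.cong)
    moreover have "integrable M (\<lambda>\<omega>. \<Sum>i = 1..n. \<Sum>j = 1..n. indicat_real (C i j) \<omega>)"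
      by (intro Bochner_Integration.integrable_sum int)
    ultimately show ?thesis
      unfolding W_def by (simp add: prob_space)
  qed
  \<comment> \<open>The \<open>n\<close> diagonal pairs are always close and are bounded by 1; all
    others are bounded by \<open>q\<close>.\<close>
  also have "(\<Sum>i = 1..n. \<Sum>j = 1..n. prob (C i j)) \<le> (\<Sum>i = 1..n. \<Sum>j = 1..n. of_bool (i = j) + q)"
    using assms(6) close by (intro sum_mono) (auto simp: C_def intro: add_increasing2)
  also have "\<dots> = real n + (real n)\<^sup>2 * q"
    by (simp add: sum.distrib power2_eq_square algebra_simps)
  finally have EW: "expectation W \<le> real n + (real n)\<^sup>2 * q + 2 * real n * b / \<delta>"
    by simp
  have "{\<omega> \<in> space M. \<epsilon> < real (card (active_set n b (\<lambda>i. d i \<omega>))) / real n}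
      \<subseteq> {\<omega> \<in> space M. (\<epsilon> * real n)\<^sup>2 \<le> W \<omega>}"
  proof safe
    fix \<omega> assume \<omega>: "\<omega> \<in> space M" "\<epsilon> < real (card (active_set n b (\<lambda>i. d i \<omega>))) / real n"
    then have "\<epsilon> * real n \<le> real (card (active_set n b (\<lambda>i. d i \<omega>)))"
      using assms(3) by (simp add: field_simps)
    then have "(\<epsilon> * real n)\<^sup>2 \<le> (real (card (active_set n b (\<lambda>i. d i \<omega>))))\<^sup>2"
      using assms by (intro power_mono) auto
    also have "\<dots> \<le> W \<omega>"
      using card_active_set_square_le[OF assms(2-4), of "\<lambda>i. d i \<omega>"] \<omega>(1)
      by (simp add: W_def C_def indicator_def)
    finally show "(\<epsilon> * real n)\<^sup>2 \<le> W \<omega>" .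
  qed
  then have "prob {\<omega> \<in> space M. \<epsilon> < real (card (active_set n b (\<lambda>i. d i \<omega>))) / real n}
      \<le> prob {\<omega> \<in> space M. (\<epsilon> * real n)\<^sup>2 \<le> W \<omega>}"
    using borel_measurable_integrable[OF W] by (intro finite_measure_mono) auto
  also have "\<dots> \<le> expectation W / (\<epsilon> * real n)\<^sup>2"
    using W W_nonneg assms by (intro integral_Markov_inequality_measure[where A = "{}"]) auto
  also have "\<dots> \<le> (real n + (real n)\<^sup>2 * q + 2 * real n * b / \<delta>) / (\<epsilon> * real n)\<^sup>2"
    using EW by (intro divide_right_mono) auto
  also have "\<dots> = (q + (1 + 2 * b / \<delta>) / real n) / \<epsilon>\<^sup>2"
    using assms by (simp add: field_simps power2_eq_square)
  finally show ?thesis .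
qed

text \<open>The subfamilies indexed by the disjoint sets \<open>{i}\<close> and \<open>{j}\<close>
  are independent; evaluating each at its single index recovers the two variables.\<close>

lemma (in prob_space) indep_vars_imp_indep_var:
  assumes ind: "indep_vars M' X I" and "i \<in> I" "j \<in> I" "i \<noteq> j"
  shows "indep_var (M' i) (X i) (M' j) (X j)"
proof -
  have "indep_var (M' i) ((\<lambda>x. x i) \<circ> (\<lambda>\<omega>. restrict (\<lambda>k. X k \<omega>) {i}))
      (M' j) ((\<lambda>x. x j) \<circ> (\<lambda>\<omega>. restrict (\<lambda>k. X k \<omega>) {j}))"
    by (rule indep_var_compose[OF indep_var_restrict[OF ind]])
      (use assms in \<open>auto intro: measurable_component_singleton\<close>)
  then show ?thesis
    by (simp add: comp_def)
qed

section \<open>The limit\<close>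

theorem theorem3p2:
  fixes M :: "'a measure" and d :: "nat \<Rightarrow> 'a \<Rightarrow> real"
    and f :: "real \<Rightarrow> real" and b \<epsilon> :: real
  assumes "prob_space M"
    and "b > 0"
    and "\<And>x. 0 \<le> f x"
    and "prob_space.indep_vars M (\<lambda>_. borel) d {1..}"
    and "\<And>i. i \<ge> 1 \<Longrightarrow> distributed M lborel (d i) (\<lambda>x. ennreal (f x))"
    and "\<epsilon> > 0"
  shows "(\<lambda>n. measure M {\<omega> \<in> space M.
           real (card (active_set n b (\<lambda>i. d i \<omega>))) / real n \<le> \<epsilon>}) \<longlonglongrightarrow> 1"
proof -
  interpret prob_space M by fact
  define \<mu> where "\<mu> = density lborel (\<lambda>x. ennreal (f x))"
  define q where "q m = measure (\<mu> \<Otimes>\<^sub>M \<mu>) {(x, y). \<bar>x - y\<bar> \<le> inverse (real (Suc m))}" for m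
  define bad where
    "bad n = {\<omega> \<in> space M. \<epsilon> < real (card (active_set n b (\<lambda>i. d i \<omega>))) / real n}" for n
  have rv: "random_variable borel (d i)" if "i \<ge> 1" for i
    using distributed_measurable[OF assms(5)[OF that]] by simp
  have distr: "distr M borel (d i) = \<mu>" if "i \<ge> 1" for i
    using distributed_distr_eq_density[OF assms(5)[OF that]]
    by (simp add: \<mu>_def cong: distr_cong)
  have f: "(\<lambda>x. ennreal (f x)) \<in> borel_measurable borel"
    using distributed_borel_measurable[OF assms(5)[of 1]] by simp
  have "prob_space \<mu>"
    using prob_space_distr[OF rv[of 1]] distr[of 1] by simp
  then have "finite_measure \<mu>"
    by (rule prob_space.finite_measure)
  \<comment> \<open>A law with a Lebesgue density inherits the null sets of Lebesgue measure, so it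
    has no atoms.\<close>
  moreover have "emeasure \<mu> {x} = 0" for x
  proof -
    have "{x} \<in> null_sets lborel"
      by (simp add: null_sets_def)
    then have "{x} \<in> null_sets \<mu>"
      using f absolutely_continuousI_density[of "\<lambda>x. ennreal (f x)" lborel]
      by (auto simp: \<mu>_def absolutely_continuous_def)
    then show ?thesis
      by (rule null_setsD1)
  qed
  ultimately have q: "q \<longlonglongrightarrow> 0"
    unfolding q_def by (intro near_diagonal_tendsto_0) (auto simp: \<mu>_def)
  \<comment> \<open>By independence the joint law of two distinct coordinates is the product of
    \<mu> with itself, so \<open>q m\<close> is in fact the exact probability.\<close>
  have close: "prob {\<omega> \<in> space M. \<bar>d i \<omega> - d j \<omega>\<bar> \<le> inverse (real (Suc m))} \<le> q m"
    if ij: "i \<ge> 1" "j \<ge> 1" "i \<noteq> j" for i j m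
  proof -
    have "indep_var borel (d i) borel (d j)"
      using indep_vars_imp_indep_var[OF assms(4)] ij by simp
    then have "\<mu> \<Otimes>\<^sub>M \<mu> = distr M (borel \<Otimes>\<^sub>M borel) (\<lambda>\<omega>. (d i \<omega>, d j \<omega>))"
      using ij by (simp add: indep_var_distribution_eq distr)
    moreover have "{p \<in> space (borel \<Otimes>\<^sub>M borel). \<bar>fst p - snd p\<bar> \<le> inverse (real (Suc m))}
        \<in> sets (borel \<Otimes>\<^sub>M borel)"
      by measurable
    then have "{(x, y). \<bar>x - y\<bar> \<le> inverse (real (Suc m))} \<in> sets (borel \<Otimes>\<^sub>M borel)"
      by (simp add: space_pair_measure case_prod_beta')
    ultimately have "q m = prob ((\<lambda>\<omega>. (d i \<omega>, d j \<omega>)) -` {(x, y). \<bar>x - y\<bar> \<le> inverse (real (Suc m))} \<inter> space M)"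
      using rv ij by (simp add: q_def measure_distr)
    also have "\<dots> = prob {\<omega> \<in> space M. \<bar>d i \<omega> - d j \<omega>\<bar> \<le> inverse (real (Suc m))}"
      by (rule arg_cong[where f = prob]) auto
    finally show ?thesis
      by simp
  qed
  have "(\<lambda>n. prob (bad n)) \<longlonglongrightarrow> 0"
  proof (rule LIMSEQ_I)
    fix e :: real assume "e > 0"
    \<comment> \<open>The order of choices matters: \<open>m\<close>, and with it \<delta>, is fixed
      first, so that the remaining term is a constant over \<open>n\<close>. The factor
      \<open>\<epsilon>\<^sup>2\<close> cancels the denominator of the Markov bound.\<close>
    with q obtain m where "\<bar>q m\<bar> < e / 2 * \<epsilon>\<^sup>2"
      using assms(6) LIMSEQ_D[of q 0 "e / 2 * \<epsilon>\<^sup>2"] by auto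
    then have qm: "q m / \<epsilon>\<^sup>2 < e / 2"
      using assms(6) by (simp add: field_simps)
    define \<delta> where "\<delta> = inverse (real (Suc m))"
    have "(\<lambda>n. (1 + 2 * b / \<delta>) / \<epsilon>\<^sup>2 / real n) \<longlonglongrightarrow> 0"
      by (rule lim_const_over_n)
    from order_tendstoD(2)[OF this, of "e / 2"] \<open>e > 0\<close>
    obtain k where k: "\<And>n. n \<ge> k \<Longrightarrow> (1 + 2 * b / \<delta>) / \<epsilon>\<^sup>2 / real n < e / 2"
      unfolding eventually_sequentially by (metis half_gt_zero)
    have "norm (prob (bad n) - 0) < e" if n: "n \<ge> max 1 k" for n
    proof -
      have "prob (bad n) \<le> (q m + (1 + 2 * b / \<delta>) / real n) / \<epsilon>\<^sup>2"
        unfolding bad_def using n close assms(2,6) rv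
        by (intro prob_card_active_set_gt_le) (auto simp: \<delta>_def q_def)
      also have "\<dots> = q m / \<epsilon>\<^sup>2 + (1 + 2 * b / \<delta>) / \<epsilon>\<^sup>2 / real n"
        by (simp add: add_divide_distrib ac_simps)
      also have "\<dots> < e"
        using add_strict_mono[OF qm k[of n]] n by simp
      finally show ?thesis
        by simp
    qed
    then show "\<exists>k. \<forall>n\<ge>k. norm (prob (bad n) - 0) < e"
      by blast
  qed
  then have "(\<lambda>n. 1 - prob (bad n)) \<longlonglongrightarrow> 1"
    by (auto intro: tendsto_eq_intros)
  \<comment> \<open>Complements are taken for \<open>n \<ge> 1\<close>, where the count is known to
    be measurable; the limit ignores the term at \<open>n = 0\<close>.\<close>
  moreover have "eventually (\<lambda>n. 1 - prob (bad n)
      = prob {\<omega> \<in> space M. real (card (active_set n b (\<lambda>i. d i \<omega>))) / real n \<le> \<epsilon>}) sequentially"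
    using eventually_ge_at_top[of 1]
  proof eventually_elim
    case (elim n)
    have "bad n \<in> events"
      unfolding bad_def using measurable_card_active_set[OF rv assms(2) elim] by measurable
    moreover have "space M - bad n
        = {\<omega> \<in> space M. real (card (active_set n b (\<lambda>i. d i \<omega>))) / real n \<le> \<epsilon>}"
      by (auto simp: bad_def)
    ultimately show ?case
      by (simp flip: prob_compl)
  qed
  ultimately show ?thesis
    by (rule Lim_transform_eventually)
qed

end
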